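(* Let $q$ be a prime power, $n\geq1$, $1\neq\sigma\in\mathrm{Aut}(\mathbb F_q)$ with fixed field $\mathbb F_s$, and define $m(r)=\frac{q^{n+1-r}-1}{q-1}+\frac{s^r-1}{s-1}$. Then for every $r=1,\dots,n+1$, \[\max\{\theta_M: M\in M_{n+1}(q),\ \mathrm{rank}(M)=r\}\leq m(r).\]
   Context: $V^*=\mathbb F_q^{n+1}$ (row vectors), $V=\mathbb F_q^{n+1}$ (column vectors); $\xi^\sigma$ is $\xi$ with $\sigma$ applied coordinatewise. $\theta_M$ is the number of points $[\xi]\in\mathrm{PG}(V^* )$ such that $\ker(\xi^\sigma)\subseteq\ker(\xi M)$, where $\ker\eta=\{x\in V:\eta x=0\}$ (equal to $V$ if $\eta=0$); equivalently, $\xi M$ is a (possibly zero) scalar multiple of $\xi^\sigma$. *)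

theory Defs
  imports "HOL-Analysis.Analysis"
begin

text \<open>
  The field with \<open>q\<close> elements is a type \<open>'a\<close> of class \<open>{field, finite}\<close> with \<open>CARD('a) = q\<close>;
  that \<open>q\<close> is a prime power is then automatic. Row and column vectors of length \<open>n + 1\<close> are
  both elements of \<open>'a ^ 'n\<close> with \<open>CARD('n) = n + 1\<close>; a row vector acts on a matrix by \<open>v*\<close>
  and on a column vector by \<^const>\<open>scalar_product\<close>.
\<close>

definition field_automorphism :: "('a::field \<Rightarrow> 'a) \<Rightarrow> bool" where
  "field_automorphism \<sigma> \<longleftrightarrow> bij \<sigma> \<and> \<sigma> 1 = 1 \<and>
     (\<forall>x y. \<sigma> (x + y) = \<sigma> x + \<sigma> y) \<and> (\<forall>x y. \<sigma> (x * y) = \<sigma> x * \<sigma> y)"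

definition fixed_field :: "('a \<Rightarrow> 'a) \<Rightarrow> 'a set" where
  "fixed_field \<sigma> = {x. \<sigma> x = x}"

definition twist :: "('a \<Rightarrow> 'a) \<Rightarrow> 'a ^ 'n \<Rightarrow> 'a ^ 'n" where
  "twist \<sigma> \<xi> = (\<chi> i. \<sigma> (\<xi> $ i))"

definition ker :: "'a::field ^ 'n \<Rightarrow> ('a ^ 'n) set" where
  "ker \<eta> = {x. scalar_product \<eta> x = 0}"

text \<open>
  A projective point \<open>[\<xi>]\<close> is the one-dimensional subspace spanned by \<open>\<xi> \<noteq> 0\<close>. The condition
  \<open>ker (twist \<sigma> \<xi>) \<subseteq> ker (\<xi> v* M)\<close> does not depend on the choice of the representative \<open>\<xi>\<close>.
\<close>

definition theta :: "('a::field \<Rightarrow> 'a) \<Rightarrow> 'a ^ 'n ^ 'n \<Rightarrow> nat" where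
  "theta \<sigma> M = card {vec.span {\<xi>} |\<xi>. \<xi> \<noteq> 0 \<and> ker (twist \<sigma> \<xi>) \<subseteq> ker (\<xi> v* M)}"

definition m_bound :: "nat \<Rightarrow> nat \<Rightarrow> nat \<Rightarrow> nat \<Rightarrow> real" where
  "m_bound q s n r =
     (real q ^ (n + 1 - r) - 1) / (real q - 1) + (real s ^ r - 1) / (real s - 1)"

end

theory Submission
  imports Defs
begin

text \<open>
  If \<open>\<xi> M\<close> is a multiple \<open>\<lambda>\<close> of \<open>\<xi>\<^sup>\<sigma>\<close>, then either \<open>\<lambda> = 0\<close>, so that \<open>\<xi>\<close> lies in the left kernel
  of \<open>M\<close>, which has dimension \<open>n + 1 - r\<close>, or \<open>\<lambda> \<noteq> 0\<close>. Among the solutions of the second kind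
  choose a basis \<open>e\<^sub>1, \<dots>, e\<^sub>d\<close> of their span, with multipliers \<open>\<lambda>\<^sub>i\<close>. The vectors \<open>e\<^sub>i\<^sup>\<sigma>\<close> are
  independent and lie in the row space of \<open>M\<close>, hence \<open>d \<le> r\<close>. If \<open>\<Sum> x\<^sub>i e\<^sub>i\<close> is again such a
  solution, comparing coefficients gives \<open>x\<^sub>i \<lambda>\<^sub>i = \<lambda> \<sigma>(x\<^sub>i)\<close>. Normalising the last nonzero
  coefficient \<open>x\<^sub>j\<close> to 1 forces \<open>\<lambda> = \<lambda>\<^sub>j\<close>, and then each of the remaining coefficients lies in
  an at most one-dimensional space over the fixed field. Thus there are at most
  \<open>\<Sum>\<^sub>j s\<^sup>j\<^sup>-\<^sup>1 = (s\<^sup>d - 1) / (s - 1)\<close> such points.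
\<close>

section \<open>Counting the projective points of a span\<close>

lemma span_singleton_scale:
  fixes x :: "'a::field ^ 'n"
  assumes "a \<noteq> 0"
  shows "vec.span {a *s x} = vec.span {x}"
proof -
  have "x \<in> vec.span {a *s x}"
    using assms vec.span_scale[OF vec.span_base[of "a *s x" "{a *s x}"], of "inverse a"]
    by simp
  moreover have "a *s x \<in> vec.span {x}"
    by (simp add: vec.span_base vec.span_scale)
  ultimately show ?thesis
    by (intro equalityI vec.span_minimal) auto
qed

text \<open>Every vector in the set comes from a choice function in \<open>PiE C S\<close>.
  Different choices may coincide, so this is only an upper bound.\<close>

lemma card_combinations_le:
  fixes C :: "('a::{field,finite} ^ 'n) set"
  assumes "\<And>c. c \<in> C \<Longrightarrow> card (S c) \<le> t"
  shows "card {b + (\<Sum>c\<in>C. x c *s c) | x. \<forall>c\<in>C. x c \<in> S c} \<le> t ^ card C"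
proof -
  have "{b + (\<Sum>c\<in>C. x c *s c) | x. \<forall>c\<in>C. x c \<in> S c}
      \<subseteq> (\<lambda>x. b + (\<Sum>c\<in>C. x c *s c)) ` PiE C S"
  proof clarify
    fix x assume x: "\<forall>c\<in>C. x c \<in> S c"
    then have "restrict x C \<in> PiE C S" by auto
    moreover have "(\<Sum>c\<in>C. x c *s c) = (\<Sum>c\<in>C. restrict x C c *s c)"
      by (rule sum.cong) auto
    ultimately show "b + (\<Sum>c\<in>C. x c *s c) \<in> (\<lambda>x. b + (\<Sum>c\<in>C. x c *s c)) ` PiE C S"
      by (intro image_eqI[where x = "restrict x C"]) (simp_all only:)
  qed
  then have "card {b + (\<Sum>c\<in>C. x c *s c) | x. \<forall>c\<in>C. x c \<in> S c} \<le> card (PiE C S)"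
    by (rule surj_card_le[rotated]) (auto intro!: finite_PiE)
  also have "\<dots> = (\<Prod>c\<in>C. card (S c))"
    by (simp add: card_PiE)
  also have "\<dots> \<le> (\<Prod>c\<in>C. t)"
    using assms by (intro prod_mono) auto
  finally show ?thesis by simp
qed

text \<open>
  Points of the span of \<open>C \<union> {b}\<close> outside the span of \<open>C\<close> have a unique representative
  with coefficient 1 at \<open>b\<close>, so each new basis vector adds at most \<open>t ^ card C\<close> points.
\<close>

lemma card_points_in_span_le:
  fixes G B :: "('a::{field,finite} ^ 'n) set"
  assumes scale: "\<And>a x. a \<noteq> 0 \<Longrightarrow> x \<in> G \<Longrightarrow> a *s x \<in> G"
    and nonzero: "0 \<notin> G"
    and coeff: "\<And>b. b \<in> B \<Longrightarrow> \<exists>S. (\<forall>c\<in>B. card (S c) \<le> t) \<and>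
        (\<forall>x. (\<Sum>c\<in>B. x c *s c) \<in> G \<and> x b = 1 \<longrightarrow> (\<forall>c\<in>B. x c \<in> S c))"
  shows "card {vec.span {\<xi>} | \<xi>. \<xi> \<in> G \<inter> vec.span B} \<le> (\<Sum>i<card B. t ^ i)"
proof -
  have fin: "finite A" for A :: "('a ^ 'n) set" by simp
  \<comment> \<open>The induction runs over subsets \<open>C\<close> of a fixed \<open>B\<close>,
    since \<open>coeff\<close> speaks of sums over all of \<open>B\<close>.\<close>
  have "card {vec.span {\<xi>} | \<xi>. \<xi> \<in> G \<inter> vec.span C} \<le> (\<Sum>i<card C. t ^ i)" if "C \<subseteq> B" for C
    using fin[of C] that
  proof (induction C rule: finite_induct)
    case empty
    have "{vec.span {\<xi>} | \<xi>. \<xi> \<in> G \<inter> vec.span {}} = {}"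
      using nonzero by auto
    then show ?case by simp
  next
    case (insert b C)
    have "b \<in> B" using insert.prems by simp
    from coeff[OF this] obtain S where S: "\<forall>c\<in>B. card (S c) \<le> t"
        "\<forall>x. (\<Sum>c\<in>B. x c *s c) \<in> G \<and> x b = 1 \<longrightarrow> (\<forall>c\<in>B. x c \<in> S c)"
      by (elim exE conjE)
    \<comment> \<open>Candidates for the normalised representatives of the new points: coefficient 1
      at \<open>b\<close>, the others restricted by \<open>S\<close>.\<close>
    define N where "N = {b + (\<Sum>c\<in>C. x c *s c) | x. \<forall>c\<in>C. x c \<in> S c}"
    have "{vec.span {\<xi>} | \<xi>. \<xi> \<in> G \<inter> vec.span (insert b C)}
      \<subseteq> {vec.span {\<xi>} | \<xi>. \<xi> \<in> G \<inter> vec.span C} \<union> (\<lambda>\<xi>. vec.span {\<xi>}) ` N"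
    proof clarify
      fix \<xi> assume \<xi>: "\<xi> \<in> G" "\<xi> \<in> vec.span (insert b C)"
        and notin: "vec.span {\<xi>} \<notin> (\<lambda>\<xi>. vec.span {\<xi>}) ` N"
      from \<xi>(2) obtain y where y: "\<xi> = (\<Sum>c\<in>insert b C. y c *s c)"
        using vec.span_finite[OF fin[of "insert b C"]] by auto
      have y': "\<xi> = y b *s b + (\<Sum>c\<in>C. y c *s c)"
        using insert.hyps by (simp add: y)
      \<comment> \<open>A nonzero coefficient at \<open>b\<close> could be scaled to 1, which would
        put a representative of the same point into \<open>N\<close>, against
        \<open>notin\<close>.\<close>
      have "y b = 0"
      proof (rule ccontr)
        assume yb: "y b \<noteq> 0"
        \<comment> \<open>Extending by 0 outside \<open>insert b C\<close> turns the sum over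
          \<open>insert b C\<close> into one over \<open>B\<close>, so that \<open>coeff\<close>
          applies.\<close>
        define x where "x c = (if c \<in> insert b C then y c / y b else 0)" for c
        have "(\<Sum>c\<in>insert b C. x c *s c) = (\<Sum>c\<in>insert b C. inverse (y b) *s (y c *s c))"
          by (intro sum.cong) (auto simp: x_def divide_inverse mult.commute)
        also have "\<dots> = inverse (y b) *s \<xi>"
          by (simp only: y vec.scale_sum_right)
        finally have xC: "(\<Sum>c\<in>insert b C. x c *s c) = inverse (y b) *s \<xi>" .
        have "(\<Sum>c\<in>B. x c *s c) = (\<Sum>c\<in>insert b C. x c *s c)"
          using insert.prems by (intro sum.mono_neutral_right) (auto simp: x_def)
        then have xG: "(\<Sum>c\<in>B. x c *s c) \<in> G"
          unfolding xC using yb \<xi>(1) by (simp add: scale)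
        have xb: "x b = 1" using yb by (simp add: x_def)
        have xS: "\<forall>c\<in>C. x c \<in> S c"
          using S(2)[rule_format, OF conjI[OF xG xb]] insert.prems by auto
        have "inverse (y b) *s \<xi> = b + (\<Sum>c\<in>C. x c *s c)"
          unfolding xC[symmetric] using insert.hyps xb by simp
        then have "inverse (y b) *s \<xi> \<in> N"
          unfolding N_def using xS by auto
        moreover have "vec.span {inverse (y b) *s \<xi>} = vec.span {\<xi>}"
          using yb by (intro span_singleton_scale) auto
        ultimately show False
          using notin by (metis image_eqI)
      qed
      then have "\<xi> \<in> vec.span C"
        unfolding y' by (simp add: vec.span_sum vec.span_scale vec.span_base)
      then show "\<exists>\<xi>'. vec.span {\<xi>} = vec.span {\<xi>'} \<and> \<xi>' \<in> G \<inter> vec.span C"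
        using \<xi>(1) by blast
    qed
    then have "card {vec.span {\<xi>} | \<xi>. \<xi> \<in> G \<inter> vec.span (insert b C)}
      \<le> card {vec.span {\<xi>} | \<xi>. \<xi> \<in> G \<inter> vec.span C} + card ((\<lambda>\<xi>. vec.span {\<xi>}) ` N)"
      by (intro order_trans[OF card_mono card_Un_le]) auto
    also have "card ((\<lambda>\<xi>. vec.span {\<xi>}) ` N) \<le> card N"
      by (rule card_image_le) simp
    also have "card N \<le> t ^ card C"
      unfolding N_def using S(1) insert.prems by (intro card_combinations_le) auto
    also have "card {vec.span {\<xi>} | \<xi>. \<xi> \<in> G \<inter> vec.span C} \<le> (\<Sum>i<card C. t ^ i)"
      using insert.prems by (intro insert.IH) simp
    also have "(\<Sum>i<card C. t ^ i) + t ^ card C = (\<Sum>i<card (insert b C). t ^ i)"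
      using insert.hyps by simp
    finally show ?case by simp
  qed
  from this[OF order_refl] show ?thesis .
qed

section \<open>Linear algebra: row space, left kernel, nested kernels, rank\<close>

lemma linear_vector_matrix_mult:
  "Vector_Spaces.linear (*s) (*s) (\<lambda>x. x v* (M :: 'a::field ^ 'n ^ 'm))"
  using matrix_vector_mul_linear_gen[of "transpose M"]
  by (simp only: transpose_matrix_vector[abs_def])

lemma span_rows: "vec.span (rows M) = range (\<lambda>x. x v* (M :: 'a::field ^ 'n ^ 'm))"
proof (intro equalityI)
  interpret L: Vector_Spaces.linear "(*s)" "(*s)" "\<lambda>x. x v* M"
    by (rule linear_vector_matrix_mult)
  have "rows M \<subseteq> range (\<lambda>x. x v* M)"
  proof
    fix v assume "v \<in> rows M"
    then obtain i where "v = row i M" by (auto simp: rows_def)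
    then have "v = axis i 1 v* M"
      by (simp add: vec_eq_iff row_def vector_matrix_mult_def axis_def if_distrib[of "\<lambda>a. a * _"]
          cong: if_cong)
    then show "v \<in> range (\<lambda>x. x v* M)" by blast
  qed
  then show "vec.span (rows M) \<subseteq> range (\<lambda>x. x v* M)"
    by (intro vec.span_minimal L.subspace_image) auto
  have "x v* M = (\<Sum>i\<in>UNIV. x $ i *s row i M)" for x
    by (simp add: vec_eq_iff vector_matrix_mult_def row_def)
  then show "range (\<lambda>x. x v* M) \<subseteq> vec.span (rows M)"
    by (auto intro!: vec.span_sum vec.span_scale intro: vec.span_base simp: rows_def)
qed

lemma rank_eq_dim_range: "rank M = vec.dim (range (\<lambda>x. x v* (M :: 'a::field ^ 'n ^ 'm)))"
  by (metis row_rank_def_gen span_rows vec.dim_span)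

text \<open>One half of rank-nullity: extend \<open>B\<close> to a basis \<open>C\<close> of the
  whole space. The members of \<open>B\<close> map to 0, so the images of \<open>C - B\<close>
  already span the row space.\<close>

lemma card_independent_left_kernel_le:
  fixes M :: "'a::{field,finite} ^ 'n ^ 'm"
  assumes "vec.independent B" and "\<And>x. x \<in> B \<Longrightarrow> x v* M = 0"
  shows "card B + rank M \<le> CARD('m)"
proof -
  interpret L: Vector_Spaces.linear "(*s)" "(*s)" "\<lambda>x. x v* M"
    by (rule linear_vector_matrix_mult)
  have fin: "finite A" for A :: "('a ^ 'm) set" by simp
  obtain C where C: "B \<subseteq> C" "vec.independent C" "vec.span C = UNIV"
    using assms(1)
    by (metis vec.extend_basis_superset vec.independent_extend_basis vec.span_extend_basis)
  have "range (\<lambda>x. x v* M) = vec.span ((\<lambda>x. x v* M) ` C)"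
    using C(3) by (simp add: L.span_image)
  also have "\<dots> \<subseteq> vec.span ((\<lambda>x. x v* M) ` (C - B))"
  proof (rule vec.span_minimal)
    show "(\<lambda>x. x v* M) ` C \<subseteq> vec.span ((\<lambda>x. x v* M) ` (C - B))"
    proof clarify
      fix x assume "x \<in> C"
      then show "x v* M \<in> vec.span ((\<lambda>x. x v* M) ` (C - B))"
        using assms(2)[of x] by (cases "x \<in> B") (auto intro: vec.span_zero vec.span_base)
    qed
  qed simp
  finally have "rank M \<le> card ((\<lambda>x. x v* M) ` (C - B))"
    unfolding rank_eq_dim_range by (rule vec.dim_le_card) simp
  also have "\<dots> \<le> card (C - B)"
    by (rule card_image_le) simp
  also have "\<dots> = card C - card B"
    using C(1) fin by (simp add: card_Diff_subset)
  also have "card C = CARD('m)"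
    using C(2,3) vec.dim_eq_card[of C UNIV] by (simp add: card_cart_basis)
  finally have "rank M \<le> CARD('m) - card B" .
  moreover have "card B \<le> CARD('m)"
    using \<open>card C = CARD('m)\<close> C(1) fin by (metis card_mono)
  ultimately show ?thesis by simp
qed

lemma ker_subset_imp_multiple:
  fixes \<eta> \<zeta> :: "'a::field ^ 'n"
  assumes "\<eta> \<noteq> 0" and "ker \<eta> \<subseteq> ker \<zeta>"
  shows "\<exists>c. \<zeta> = c *s \<eta>"
proof -
  obtain i where i: "\<eta> $ i \<noteq> 0"
    using assms(1) by (auto simp: vec_eq_iff)
  have "\<zeta> $ j * \<eta> $ i = \<zeta> $ i * \<eta> $ j" for j
  proof -
    \<comment> \<open>This vector is annihilated by \<open>\<eta>\<close>. Applying
      \<open>\<zeta>\<close> to it gives the vanishing of a 2 by 2 minor of the rows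
      \<open>\<eta>\<close> and \<open>\<zeta>\<close>.\<close>
    define x where "x = \<eta> $ i *s axis j 1 - \<eta> $ j *s axis i 1"
    have sp: "scalar_product v x = v $ j * \<eta> $ i - v $ i * \<eta> $ j" for v
    proof -
      have "scalar_product v x = (\<Sum>k\<in>UNIV. (if k = j then v $ k * \<eta> $ i else 0)
          - (if k = i then v $ k * \<eta> $ j else 0))"
        unfolding scalar_product_def x_def
        by (intro sum.cong) (auto simp: axis_def right_diff_distrib)
      then show ?thesis by (simp add: sum_subtractf)
    qed
    have "x \<in> ker \<eta>" by (simp add: ker_def sp)
    then have "x \<in> ker \<zeta>" using assms(2) by blast
    then show ?thesis by (simp add: ker_def sp)
  qed
  then have "\<zeta> = (\<zeta> $ i / \<eta> $ i) *s \<eta>"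
    using i by (simp add: vec_eq_iff field_simps)
  then show ?thesis ..
qed

text \<open>A diagonal 0/1 matrix with \<open>r\<close> ones has rank \<open>r\<close>. This makes
  the set whose maximum is taken nonempty.\<close>

lemma exists_matrix_rank:
  assumes "r \<le> CARD('n::finite)"
  shows "\<exists>M :: 'a::field ^ 'n ^ 'n. rank M = r"
proof -
  obtain I :: "'n set" where I: "card I = r"
    using assms obtain_subset_with_card_n by blast
  define M :: "'a ^ 'n ^ 'n" where "M = (\<chi> i. if i \<in> I then axis i 1 else 0)"
  define E :: "('a ^ 'n) set" where "E = (\<lambda>i. axis i 1) ` I"
  have row: "row i M = (if i \<in> I then axis i 1 else 0)" for i
    by (simp add: row_def M_def vec_eq_iff)
  have "E \<subseteq> cart_basis" by (auto simp: E_def cart_basis_def)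
  then have indep: "vec.independent E"
    using independent_cart_basis vec.independent_mono by blast
  have "E \<subseteq> rows M" by (force simp: E_def rows_def row)
  moreover have "rows M \<subseteq> vec.span E"
    by (auto simp: rows_def row E_def intro: vec.span_base vec.span_zero)
  moreover have "card E = r"
    unfolding E_def I[symmetric] by (rule card_image) (auto simp: inj_on_def axis_eq_axis)
  ultimately have "rank M = r"
    unfolding row_rank_def_gen using indep by (intro vec.dim_unique)
  then show ?thesis ..
qed

text \<open>Passes from a point count over a basis of size \<open>d\<close> to the closed form in
  \<open>m_bound\<close>, with \<open>d\<close> replaced by its upper bound
  \<open>e\<close>.\<close>

lemma sum_power_lessThan_le:
  fixes t d e :: nat
  assumes "t \<ge> 2" and "d \<le> e"
  shows "real (\<Sum>i<d. t ^ i) \<le> (real t ^ e - 1) / (real t - 1)"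
proof -
  have "(\<Sum>i<d. t ^ i) \<le> (\<Sum>i<e. t ^ i)"
    using assms(2) by (intro sum_mono2) auto
  then have "real (\<Sum>i<d. t ^ i) \<le> (\<Sum>i<e. real t ^ i)"
    by (metis (mono_tags, lifting) of_nat_le_iff of_nat_power of_nat_sum sum.cong)
  also have "\<dots> = (real t ^ e - 1) / (real t - 1)"
    using assms(1) by (subst geometric_sum) auto
  finally show ?thesis .
qed

section \<open>Semilinear algebra, and the points with nonzero multiplier\<close>

context
  fixes \<sigma> :: "'a::{field,finite} \<Rightarrow> 'a"
  assumes aut: "field_automorphism \<sigma>"
begin

lemma aut_add: "\<sigma> (x + y) = \<sigma> x + \<sigma> y"
  and aut_mult: "\<sigma> (x * y) = \<sigma> x * \<sigma> y"
  and aut_1: "\<sigma> 1 = 1"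
  and aut_bij: "bij \<sigma>"
  using aut by (auto simp: field_automorphism_def)

lemma aut_0: "\<sigma> 0 = 0"
  using aut_add[of 0 0] by (metis add.right_neutral add_left_cancel)

lemma aut_eq_0_iff: "\<sigma> x = 0 \<longleftrightarrow> x = 0"
  using aut_0 aut_bij by (metis bij_pointE)

lemma twist_eq_0_iff: "twist \<sigma> \<xi> = 0 \<longleftrightarrow> \<xi> = 0"
  by (simp add: twist_def vec_eq_iff aut_eq_0_iff)

lemma twist_scale: "twist \<sigma> (a *s \<xi>) = \<sigma> a *s twist \<sigma> \<xi>"
  by (simp add: twist_def vec_eq_iff aut_mult)

lemma twist_sum: "twist \<sigma> (\<Sum>c\<in>C. f c) = (\<Sum>c\<in>C. twist \<sigma> (f c))"
proof (induction C rule: infinite_finite_induct)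
  case (insert c C)
  have "twist \<sigma> (x + y) = twist \<sigma> x + twist \<sigma> y" for x y :: "'a ^ 'b"
    by (simp add: twist_def vec_eq_iff aut_add)
  with insert show ?case by simp
qed (simp_all add: twist_eq_0_iff)

lemma twist_inj: "inj (twist \<sigma>)"
  using aut_bij by (auto intro!: injI simp: twist_def vec_eq_iff bij_def inj_eq)

text \<open>Writing each coefficient as \<open>\<sigma> (u c)\<close> makes the combination the
  twist of \<open>\<Sum>c\<in>B. u c *s c\<close>, and only 0 has twist 0.\<close>

lemma twist_combination_eq_0D:
  fixes B :: "('a ^ 'n) set"
  assumes "vec.independent B" and "(\<Sum>c\<in>B. y c *s twist \<sigma> c) = 0" and "c \<in> B"
  shows "y c = 0"
proof -
  define u where "u c = inv \<sigma> (y c)" for c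
  have u: "\<sigma> (u c) = y c" for c
    unfolding u_def using aut_bij by (simp add: bij_is_surj surj_f_inv_f)
  have "twist \<sigma> (\<Sum>c\<in>B. u c *s c) = 0"
    using assms(2) by (simp add: twist_sum twist_scale u)
  then have "(\<Sum>c\<in>B. u c *s c) = 0" by (simp add: twist_eq_0_iff)
  then have "u c = 0"
    using assms(1,3) by (intro vec.independentD[of B B u c]) auto
  with u[of c] show ?thesis by (simp add: aut_0)
qed

lemma independent_twist_image:
  fixes B :: "('a ^ 'n) set"
  assumes "vec.independent B"
  shows "vec.independent (twist \<sigma> ` B)"
proof (rule vec.independent_if_scalars_zero)
  fix f x assume "(\<Sum>x\<in>twist \<sigma> ` B. f x *s x) = 0" and "x \<in> twist \<sigma> ` B"
  then show "f x = 0"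
    using twist_combination_eq_0D[OF assms, of "\<lambda>c. f (twist \<sigma> c)"]
    by (auto simp: sum.reindex[OF inj_on_subset[OF twist_inj]])
qed simp

lemma card_fixed_field_ge: "card (fixed_field \<sigma>) \<ge> 2"
proof -
  have "{0, 1} \<subseteq> fixed_field \<sigma>"
    by (auto simp: fixed_field_def aut_0 aut_1)
  then have "card {0::'a, 1} \<le> card (fixed_field \<sigma>)"
    by (intro card_mono) auto
  then show ?thesis by simp
qed

text \<open>The quotient of a solution by a nonzero solution \<open>z\<close> is fixed by
  \<open>\<sigma>\<close>, so all solutions lie in the fixed field times \<open>z\<close>.\<close>

lemma card_semilinear_solutions_le:
  assumes "b \<noteq> 0"
  shows "card {x. x * a = b * \<sigma> x} \<le> card (fixed_field \<sigma>)"
proof (cases "{x. x * a = b * \<sigma> x} \<subseteq> {0}")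
  case True
  then have "card {x. x * a = b * \<sigma> x} \<le> card {0::'a}"
    by (intro card_mono) auto
  with card_fixed_field_ge show ?thesis by simp
next
  case False
  then obtain z where z: "z \<noteq> 0" "z * a = b * \<sigma> z" by auto
  have "{x. x * a = b * \<sigma> x} \<subseteq> (\<lambda>x. x * z) ` fixed_field \<sigma>"
  proof
    fix x assume "x \<in> {x. x * a = b * \<sigma> x}"
    then have x: "x * a = b * \<sigma> x" by simp
    have "b * (\<sigma> x * z) = b * (x * \<sigma> z)"
      using x z(2) by (metis mult.assoc mult.commute)
    then have "\<sigma> x * z = x * \<sigma> z" using assms by simp
    moreover have "\<sigma> x = \<sigma> (x / z) * \<sigma> z"
      using z(1) by (simp add: aut_mult[symmetric])
    ultimately have "\<sigma> (x / z) * z = x"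
      using z(1) aut_eq_0_iff[of z] by (simp add: mult.assoc mult.commute)
    then have "\<sigma> (x / z) = x / z" using z(1) by (simp add: field_simps)
    then have "x / z \<in> fixed_field \<sigma>" by (simp add: fixed_field_def)
    moreover have "x = (x / z) * z" using z(1) by simp
    ultimately show "x \<in> (\<lambda>x. x * z) ` fixed_field \<sigma>" by blast
  qed
  then show ?thesis
    by (rule surj_card_le[rotated]) simp
qed

text \<open>The witness \<open>d\<close> is the dimension of the span of \<open>G\<close>, which can
  be smaller than the rank.\<close>

lemma card_eigenpoints_le:
  fixes M :: "'a ^ 'n ^ 'n"
  defines "G \<equiv> {\<xi>. \<xi> \<noteq> 0 \<and> (\<exists>l. l \<noteq> 0 \<and> \<xi> v* M = l *s twist \<sigma> \<xi>)}"
  shows "\<exists>d \<le> rank M. card {vec.span {\<xi>} | \<xi>. \<xi> \<in> G} \<le> (\<Sum>i<d. card (fixed_field \<sigma>) ^ i)"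
proof -
  interpret L: Vector_Spaces.linear "(*s)" "(*s)" "\<lambda>x. x v* M"
    by (rule linear_vector_matrix_mult)
  obtain B where B: "B \<subseteq> G" "vec.independent B" "G \<subseteq> vec.span B"
    using vec.maximal_independent_subset by blast
  have "\<forall>c\<in>B. \<exists>l. l \<noteq> 0 \<and> c v* M = l *s twist \<sigma> c"
    using B(1) by (auto simp: G_def)
  then obtain l where l: "\<And>c. c \<in> B \<Longrightarrow> l c \<noteq> 0" "\<And>c. c \<in> B \<Longrightarrow> c v* M = l c *s twist \<sigma> c"
    by metis
  have "card {vec.span {\<xi>} | \<xi>. \<xi> \<in> G \<inter> vec.span B} \<le> (\<Sum>i<card B. card (fixed_field \<sigma>) ^ i)"
  proof (rule card_points_in_span_le)
    fix a :: 'a and x assume a: "a \<noteq> 0" and "x \<in> G"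
    then obtain m where m: "m \<noteq> 0" "x v* M = m *s twist \<sigma> x" "x \<noteq> 0"
      by (auto simp: G_def)
    \<comment> \<open>The multiplier changes by \<open>a / \<sigma> a\<close>, because twisting
      \<open>a *s x\<close> brings out \<open>\<sigma> a\<close>.\<close>
    have "(a *s x) v* M = (a * m / \<sigma> a) *s twist \<sigma> (a *s x)"
      using a aut_eq_0_iff[of a] by (simp add: L.scale m(2) twist_scale)
    moreover have "a *s x \<noteq> 0" using a m(3) by simp
    moreover have "a * m / \<sigma> a \<noteq> 0" using a m aut_eq_0_iff[of a] by simp
    ultimately show "a *s x \<in> G" unfolding G_def by blast
  next
    show "0 \<notin> G" by (simp add: G_def)
  next
    fix b assume b: "b \<in> B"
    have "x c \<in> {x. x * l c = l b * \<sigma> x}"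
      if x: "(\<Sum>c\<in>B. x c *s c) \<in> G" "x b = 1" and c: "c \<in> B" for x c
    proof -
      obtain m where m: "(\<Sum>c\<in>B. x c *s c) v* M = m *s twist \<sigma> (\<Sum>c\<in>B. x c *s c)"
        using x(1) by (auto simp: G_def)
      have "(\<Sum>c\<in>B. (x c * l c - m * \<sigma> (x c)) *s twist \<sigma> c)
        = (\<Sum>c\<in>B. x c *s (c v* M)) - (\<Sum>c\<in>B. m *s (\<sigma> (x c) *s twist \<sigma> c))"
        by (simp add: l(2) vec.scale_left_diff_distrib sum_subtractf)
      also have "\<dots> = 0"
        using m by (simp add: L.sum L.scale twist_sum twist_scale vec.scale_sum_right)
      finally have "x c * l c - m * \<sigma> (x c) = 0" if "c \<in> B" for c
        using twist_combination_eq_0D[OF B(2), of "\<lambda>c. x c * l c - m * \<sigma> (x c)"] that by simp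
      \<comment> \<open>With \<open>x b = 1\<close>, the equation at \<open>b\<close> reads
        \<open>m = l b\<close>. Inserting this in the equation at \<open>c\<close> gives the
        claim.\<close>
      from this[OF b] this[OF c] show ?thesis by (simp add: x(2) aut_1)
    qed
    moreover have "card {x. x * l c = l b * \<sigma> x} \<le> card (fixed_field \<sigma>)" for c
      by (rule card_semilinear_solutions_le[OF l(1)[OF b]])
    ultimately show "\<exists>S. (\<forall>c\<in>B. card (S c) \<le> card (fixed_field \<sigma>)) \<and>
        (\<forall>x. (\<Sum>c\<in>B. x c *s c) \<in> G \<and> x b = 1 \<longrightarrow> (\<forall>c\<in>B. x c \<in> S c))"
      by (intro exI[of _ "\<lambda>c. {x. x * l c = l b * \<sigma> x}"]) blast
  qed
  moreover have "\<xi> \<in> G \<inter> vec.span B \<longleftrightarrow> \<xi> \<in> G" for \<xi> using B(3) by blast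
  moreover have "card B \<le> rank M"
  proof -
    have "twist \<sigma> c \<in> range (\<lambda>x. x v* M)" if "c \<in> B" for c
    proof -
      \<comment> \<open>Here the nonzero multiplier matters: dividing by it puts
        \<open>twist \<sigma> c\<close> into the row space, which bounds \<open>card B\<close> by
        the rank.\<close>
      have "(inverse (l c) *s c) v* M = twist \<sigma> c"
        using l[OF that] by (simp add: L.scale)
      then show ?thesis by (metis rangeI)
    qed
    then have "card (twist \<sigma> ` B) \<le> rank M"
      unfolding rank_eq_dim_range
      by (intro vec.independent_card_le_dim independent_twist_image B(2)) auto
    moreover have "card (twist \<sigma> ` B) = card B"
      using twist_inj by (intro card_image) (auto simp: inj_on_def inj_def)
    ultimately show ?thesis by simp
  qed
  ultimately show ?thesis
    by (intro exI[of _ "card B"] conjI) simp_all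
qed

section \<open>Adding the two kinds of points, and the maximum\<close>

lemma theta_le_m_bound:
  fixes M :: "'a ^ 'n ^ 'n"
  assumes "CARD('n) = n + 1"
  shows "real (theta \<sigma> M) \<le> m_bound (CARD('a)) (card (fixed_field \<sigma>)) n (rank M)"
proof -
  define K where "K = {\<xi> :: 'a ^ 'n. \<xi> \<noteq> 0 \<and> \<xi> v* M = 0}"
  define G where "G = {\<xi> :: 'a ^ 'n. \<xi> \<noteq> 0 \<and> (\<exists>l. l \<noteq> 0 \<and> \<xi> v* M = l *s twist \<sigma> \<xi>)}"
  have "{vec.span {\<xi>} |\<xi>. \<xi> \<noteq> 0 \<and> ker (twist \<sigma> \<xi>) \<subseteq> ker (\<xi> v* M)}
      \<subseteq> {vec.span {\<xi>} | \<xi>. \<xi> \<in> K} \<union> {vec.span {\<xi>} | \<xi>. \<xi> \<in> G}"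
  proof clarify
    fix \<xi> assume \<xi>: "\<xi> \<noteq> 0" "ker (twist \<sigma> \<xi>) \<subseteq> ker (\<xi> v* M)"
      and notG: "\<nexists>\<xi>'. vec.span {\<xi>} = vec.span {\<xi>'} \<and> \<xi>' \<in> G"
    obtain m where m: "\<xi> v* M = m *s twist \<sigma> \<xi>"
      using ker_subset_imp_multiple[OF _ \<xi>(2)] \<xi>(1) by (auto simp: twist_eq_0_iff)
    with notG \<xi>(1) have "m = 0" unfolding G_def by blast
    with m \<xi>(1) have "\<xi> \<in> K" by (simp add: K_def)
    then show "\<exists>\<xi>'. vec.span {\<xi>} = vec.span {\<xi>'} \<and> \<xi>' \<in> K" by blast
  qed
  then have "theta \<sigma> M \<le> card {vec.span {\<xi>} | \<xi>. \<xi> \<in> K} + card {vec.span {\<xi>} | \<xi>. \<xi> \<in> G}"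
    unfolding theta_def by (intro order_trans[OF card_mono card_Un_le]) simp_all
  then have "real (theta \<sigma> M)
      \<le> real (card {vec.span {\<xi>} | \<xi>. \<xi> \<in> K}) + real (card {vec.span {\<xi>} | \<xi>. \<xi> \<in> G})"
    by (simp only: of_nat_le_iff flip: of_nat_add)
  also have "real (card {vec.span {\<xi>} | \<xi>. \<xi> \<in> K})
      \<le> (real (CARD('a)) ^ (n + 1 - rank M) - 1) / (real (CARD('a)) - 1)"
  proof -
    interpret L: Vector_Spaces.linear "(*s)" "(*s)" "\<lambda>x. x v* M"
      by (rule linear_vector_matrix_mult)
    obtain B where B: "B \<subseteq> K" "vec.independent B" "K \<subseteq> vec.span B"
      using vec.maximal_independent_subset by blast
    have "card {vec.span {\<xi>} | \<xi>. \<xi> \<in> K \<inter> vec.span B} \<le> (\<Sum>i<card B. CARD('a) ^ i)"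
    proof (rule card_points_in_span_le)
      fix b
      show "\<exists>S. (\<forall>c\<in>B. card (S c) \<le> CARD('a)) \<and>
        (\<forall>x. (\<Sum>c\<in>B. x c *s c) \<in> K \<and> x b = 1 \<longrightarrow> (\<forall>c\<in>B. x c \<in> S c))"
        \<comment> \<open>Coefficients of kernel vectors are unrestricted, so \<open>t\<close> is
          the size of the field and the general count gives the number of points of a projective
          space.\<close>
        by (intro exI[of _ "\<lambda>_. UNIV"]) simp
    qed (auto simp: K_def L.scale)
    moreover have "K \<inter> vec.span B = K" using B(3) by blast
    moreover have "card B + rank M \<le> n + 1"
      using card_independent_left_kernel_le[OF B(2), of M] B(1) assms by (auto simp: K_def)
    moreover have "CARD('a) \<ge> 2"
      using card_mono[of "UNIV :: 'a set" "{0, 1}"] by simp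
    ultimately have "card {vec.span {\<xi>} | \<xi>. \<xi> \<in> K} \<le> (\<Sum>i<card B. CARD('a) ^ i)"
        and "real (\<Sum>i<card B. CARD('a) ^ i)
          \<le> (real (CARD('a)) ^ (n + 1 - rank M) - 1) / (real (CARD('a)) - 1)"
      by (simp, intro sum_power_lessThan_le) auto
    then show ?thesis by linarith
  qed
  also have "real (card {vec.span {\<xi>} | \<xi>. \<xi> \<in> G})
      \<le> (real (card (fixed_field \<sigma>)) ^ rank M - 1) / (real (card (fixed_field \<sigma>)) - 1)"
  proof -
    obtain d where "d \<le> rank M"
        "card {vec.span {\<xi>} | \<xi>. \<xi> \<in> G} \<le> (\<Sum>i<d. card (fixed_field \<sigma>) ^ i)"
      using card_eigenpoints_le[of M] unfolding G_def by blast
    then show ?thesis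
      using sum_power_lessThan_le[OF card_fixed_field_ge, of d "rank M"] by linarith
  qed
  finally show ?thesis
    unfolding m_bound_def by simp
qed

end

theorem theorem3p10:
  fixes \<sigma> :: "'a::{field,finite} \<Rightarrow> 'a" and q s n r :: nat
  assumes "CARD('a) = q"
    and "CARD('n::finite) = n + 1" and "n \<ge> 1"
    and "field_automorphism \<sigma>" and "\<sigma> \<noteq> id"
    and "card (fixed_field \<sigma>) = s"
    and "1 \<le> r" and "r \<le> n + 1"
  shows "real (Max {theta \<sigma> M |M :: 'a ^ 'n ^ 'n. rank M = r}) \<le> m_bound q s n r"
proof -
  let ?T = "{theta \<sigma> M |M :: 'a ^ 'n ^ 'n. rank M = r}"
  have "?T \<noteq> {}"
    using exists_matrix_rank[where 'n = 'n and 'a = 'a, of r] assms(2,8) by auto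
  \<comment> \<open>Finite and nonempty, so \<open>Max\<close> is attained and the bound for a
    single matrix suffices.\<close>
  then have "Max ?T \<in> ?T"
    by (intro Max_in) auto
  then obtain M :: "'a ^ 'n ^ 'n" where "rank M = r" "Max ?T = theta \<sigma> M" by auto
  with theta_le_m_bound[OF assms(4,2), of M] show ?thesis
    by (simp only: assms(1,6))
qed

end
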